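(* Let $\lambda>0$ and let $u_0\in\mathrm{BPC}^2(\mathbb{R})\cap L^1(\mathbb{R})$ be nonnegative and not identically zero. Define $m_\infty:=\|u_0\|_{L^\infty}$, $m_1:=\|u_0\|_{L^1}$ and $$\tau:=\left(\frac{m_1}{\sqrt{4\pi}\,m_\infty}\right)^2.$$ Assume $$\psi_\infty^*:=\ln m_\infty-\int_\tau^{+\infty}\lambda e^{-2\lambda s}\ln s\,ds+e^{-2\lambda\tau}\ln\sqrt\tau<0.$$ Then the solution $u$ of $\partial_tu=\partial_{xx}u+\lambda u\ln(u^2)$, $t>0$, $x\in\mathbb{R}$, starting from $u_0$, decays superexponentially in the sense that there is a function $\psi:[0,\infty)\to\mathbb{R}$ with $\psi(t)\to\psi_\infty^*<0$ as $t\to\infty$ such that, for all $t\ge0$ and $x\in\mathbb{R}$, $$0\le u(t,x)\le\min\left(m_\infty,\frac{m_1}{\sqrt{4\pi t}}\right)e^{\psi(t)e^{2\lambda t}}.$$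
   Context: At $t=0$ the minimum is understood as $m_\infty$. $\mathrm{BPC}^2(\mathbb{R})$ denotes the set of functions $u_0:\mathbb{R}\to\mathbb{R}$ that are continuous and bounded, with continuous and bounded derivative, and bounded and piecewise continuous second derivative. The nonlinearity $z\mapsto\lambda z\ln(z^2)$ is extended by the value $0$ at $z=0$. Notion of solution: for $u_0\in\mathrm{BPC}^2(\mathbb{R})$, a (global) solution starting from $u_0$ is a function $u:[0,\infty)\times\mathbb{R}\to\mathbb{R}$ such that, for every $T>0$: $u$ is continuous and bounded on $[0,T]\times\mathbb{R}$; $u_t,u_x,u_{xx}$ exist and are continuous on $(0,T]\times\mathbb{R}$; $u$ satisfies the equation on $(0,T]\times\mathbb{R}$; $u(t,x)$ is uniformly bounded as $|x|\to\infty$ for $t\in[0,T]$; and $u(0,\cdot)=u_0$. For $u_0\ge0$ such a solution exists and is unique. *)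

theory Defs
  imports "HOL-Analysis.Analysis" "HOL-Probability.Essential_Supremum"
begin

text \<open>Piecewise continuity is taken in the usual sense on an unbounded line: the exceptional set
  has only finitely many points in each bounded interval, and both one-sided limits exist (and are
  finite) at each of them. The values of the function at the exceptional points are irrelevant.\<close>

definition piecewise_continuous_off :: "real set \<Rightarrow> (real \<Rightarrow> real) \<Rightarrow> bool" where
  "piecewise_continuous_off S g \<longleftrightarrow>
     (\<forall>a b. finite (S \<inter> {a..b})) \<and>
     continuous_on (- S) g \<and>
     (\<forall>s\<in>S. (\<exists>l. (g \<longlongrightarrow> l) (at_left s)) \<and> (\<exists>l. (g \<longlongrightarrow> l) (at_right s)))"

text \<open>The second derivative is only required to exist off the exceptional set.\<close>

definition BPC2 :: "(real \<Rightarrow> real) set" where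
  "BPC2 = {f. continuous_on UNIV f \<and> bounded (range f) \<and>
     (\<exists>f'. (\<forall>x. (f has_real_derivative f' x) (at x)) \<and>
           continuous_on UNIV f' \<and> bounded (range f') \<and>
           (\<exists>f'' S. (\<forall>x\<in>- S. (f' has_real_derivative f'' x) (at x)) \<and>
                    piecewise_continuous_off S f'' \<and> bounded (f'' ` (- S))))}"

definition log_nonlinearity :: "real \<Rightarrow> real \<Rightarrow> real" where
  "log_nonlinearity lam z = (if z = 0 then 0 else lam * z * ln (z\<^sup>2))"

text \<open>Since the conditions are imposed for every \<open>T > 0\<close>, the time derivative at \<open>t = T\<close> is an
  ordinary two-sided derivative. Values of \<open>u\<close> at negative times play no role.\<close>

definition solution_from :: "real \<Rightarrow> (real \<Rightarrow> real) \<Rightarrow> (real \<Rightarrow> real \<Rightarrow> real) \<Rightarrow> bool" where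
  "solution_from lam u0 u \<longleftrightarrow>
     (\<forall>T>0.
        continuous_on ({0..T} \<times> UNIV) (\<lambda>(t, x). u t x) \<and>
        bounded ((\<lambda>(t, x). u t x) ` ({0..T} \<times> UNIV)) \<and>
        (\<exists>ut ux uxx.
           (\<forall>t\<in>{0<..T}. \<forall>x.
              ((\<lambda>s. u s x) has_real_derivative ut t x) (at t) \<and>
              ((\<lambda>y. u t y) has_real_derivative ux t x) (at x) \<and>
              ((\<lambda>y. ux t y) has_real_derivative uxx t x) (at x)) \<and>
           continuous_on ({0<..T} \<times> UNIV) (\<lambda>(t, x). ut t x) \<and>
           continuous_on ({0<..T} \<times> UNIV) (\<lambda>(t, x). ux t x) \<and>
           continuous_on ({0<..T} \<times> UNIV) (\<lambda>(t, x). uxx t x) \<and>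
           (\<forall>t\<in>{0<..T}. \<forall>x. ut t x = uxx t x + log_nonlinearity lam (u t x))) \<and>
        (\<exists>M R. \<forall>t\<in>{0..T}. \<forall>x. \<bar>x\<bar> \<ge> R \<longrightarrow> \<bar>u t x\<bar> \<le> M)) \<and>
     (\<forall>x. u 0 x = u0 x)"

definition Linf_norm :: "(real \<Rightarrow> real) \<Rightarrow> real" where
  "Linf_norm f = real_of_ereal (esssup lborel (\<lambda>x. ereal \<bar>f x\<bar>))"

definition L1_norm :: "(real \<Rightarrow> real) \<Rightarrow> real" where
  "L1_norm f = (LINT x|lborel. \<bar>f x\<bar>)"

definition crossover_time :: "real \<Rightarrow> real \<Rightarrow> real" where
  "crossover_time m_inf m1 = (m1 / (sqrt (4 * pi) * m_inf))\<^sup>2"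

definition psi_inf :: "real \<Rightarrow> real \<Rightarrow> real \<Rightarrow> real" where
  "psi_inf lam m_inf \<tau> =
     ln m_inf - (LINT s:{\<tau>..}|lborel. lam * exp (- 2 * lam * s) * ln s)
       + exp (- 2 * lam * \<tau>) * ln (sqrt \<tau>)"

text \<open>The case \<open>t = 0\<close> is separate because division by zero yields \<open>0\<close>, whereas there the
  minimum is meant to be \<open>m_inf\<close>.\<close>

definition heat_bound :: "real \<Rightarrow> real \<Rightarrow> real \<Rightarrow> real" where
  "heat_bound m_inf m1 t = (if t = 0 then m_inf else min m_inf (m1 / sqrt (4 * pi * t)))"

end

(* Let v be the heat flow of u0, so that 0 <= v(t, x) <= h(t) with
   h(t) = min(m_inf, m1 / sqrt(4 pi t)). The function w = v exp(psi(t) exp(2 lam t)) satisfies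
   w_t - w_xx = w (psi' exp(2 lam t) + 2 lam psi exp(2 lam t)), which is at least
   2 lam w ln w = 2 lam w (ln v + psi exp(2 lam t)) as soon as psi' = 2 lam exp(-2 lam t) ln h(t).
   Taking psi(0) = 0, this w is a supersolution starting from u0, and the integral of psi' over
   (0, oo) is psi_inf. The nonlinearity is not Lipschitz at 0, but it is one-sided Lipschitz on
   bounded intervals, which is all that the comparison principle needs. *)
theory Submission
  imports Defs "HOL-Probability.Sinc_Integral"
begin

section \<open>Comparison principle\<close>

text \<open>The form of w comes from the spatially constant solutions: n' = 2 lam n ln n is solved
  by ln n(t) = C exp(2 lam t). Letting C depend on t, as psi, leaves room for a heat flow as a
  factor, whose decay enters through ln h. Since tau is the time at which m_inf and m1 / sqrt(4 pi
  t) coincide, h has only a kink there, so psi' is continuous and psi is differentiable at every t >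
  0. Splitting the integral of psi' at tau produces the terms of psi_inf. The lower bound on u is
  the same comparison, with the zero function below. The formula for v that is continuous down to t
  = 0 is not the one that is differentiated, so v carries two formulas that agree for t > 0.\<close>

lemma second_derivative_nonpos_at_max:
  fixes f f' :: "real \<Rightarrow> real"
  assumes d1: "\<And>y. (f has_real_derivative f' y) (at y)"
    and d2: "(f' has_real_derivative D) (at x)"
    and max: "\<And>y. f y \<le> f x"
  shows "D \<le> 0"
proof (rule ccontr)
  assume "\<not> D \<le> 0"
  then have "D > 0" by simp
  have 0: "f' x = 0"
    using DERIV_local_max[OF d1[of x], of 1] max by simp
  obtain d where d: "d > 0" "\<And>h. 0 < h \<Longrightarrow> h < d \<Longrightarrow> f' x < f' (x + h)"
    using DERIV_pos_inc_right[OF d2 \<open>D > 0\<close>] by auto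
  obtain y where y: "x < y" "y < x + d/2" "f (x + d/2) - f x = (x + d/2 - x) * f' y"
    using MVT2[of x "x + d/2" f f'] d(1) d1 by auto
  have "f' y > 0"
    using d(2)[of "y - x"] y d(1) 0 by simp
  then have "f (x + d/2) > f x"
    using y(3) d(1) by (smt (verit) mult_pos_pos half_gt_zero)
  with max show False by (meson not_less)
qed

text \<open>Only times up to \<open>t\<close> are compared, because the maximum over
  \<open>{0..T}\<close> may sit at the final time; a negative derivative would make \<open>f\<close>
  larger just before \<open>t\<close>.\<close>

lemma derivative_nonneg_at_left_max:
  fixes f :: "real \<Rightarrow> real"
  assumes "(f has_real_derivative D) (at t)" and "a < t"
    and "\<And>s. a \<le> s \<Longrightarrow> s \<le> t \<Longrightarrow> f s \<le> f t"
  shows "D \<ge> 0"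
proof (rule ccontr)
  assume "\<not> D \<ge> 0"
  then obtain d where d: "d > 0" "\<And>h. 0 < h \<Longrightarrow> h < d \<Longrightarrow> f t < f (t - h)"
    using DERIV_neg_dec_left[OF assms(1)] by auto
  define h where "h = min (d/2) (t - a)"
  have "f t < f (t - h)" using d assms(2) by (intro d(2)) (auto simp: h_def)
  moreover have "f (t - h) \<le> f t" using d(1) assms(2) by (intro assms(3)) (auto simp: h_def)
  ultimately show False by simp
qed

text \<open>Subtracting \<open>e * (x\<^sup>2 + 3 * t)\<close> from \<open>exp (- L * t) * z t x\<close> forces a positive maximum to be
  attained, since \<open>z\<close> is bounded, and makes the differential inequality strict.\<close>

lemma parabolic_maximum_principle:
  fixes z zt zx zxx :: "real \<Rightarrow> real \<Rightarrow> real"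
  assumes cont: "continuous_on ({0..T} \<times> UNIV) (\<lambda>(t, x). z t x)"
    and bdd: "\<And>t x. t \<in> {0..T} \<Longrightarrow> z t x \<le> M"
    and init: "\<And>x. z 0 x \<le> 0"
    and dt: "\<And>t x. t \<in> {0<..T} \<Longrightarrow> ((\<lambda>s. z s x) has_real_derivative zt t x) (at t)"
    and dx: "\<And>t x. t \<in> {0<..T} \<Longrightarrow> ((\<lambda>y. z t y) has_real_derivative zx t x) (at x)"
    and dxx: "\<And>t x. t \<in> {0<..T} \<Longrightarrow> ((\<lambda>y. zx t y) has_real_derivative zxx t x) (at x)"
    and sub: "\<And>t x. t \<in> {0<..T} \<Longrightarrow> z t x > 0 \<Longrightarrow> zt t x \<le> zxx t x + L * z t x"
    and L: "L \<ge> 0"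
    and t0: "t0 \<in> {0..T}"
  shows "z t0 x0 \<le> 0"
proof (rule ccontr)
  assume "\<not> z t0 x0 \<le> 0"
  then have pos: "z t0 x0 > 0" by simp
  with bdd[OF t0, of x0] have M: "M > 0" by linarith
  define \<phi>0 where "\<phi>0 = exp (- L * t0) * z t0 x0"
  have \<phi>0: "\<phi>0 > 0" using pos by (simp add: \<phi>0_def)
  \<comment> \<open>\<open>c - 1\<close> is the value of \<open>x\<^sup>2 + 3 * t\<close> at the
    offending point, so with \<open>e = \<phi>0 / c\<close> the penalty there is
    \<open>\<phi>0 - e\<close> and \<open>Z\<close> keeps the positive value
    \<open>e\<close>.\<close>
  define c where "c = x0\<^sup>2 + 3 * t0 + 1"
  have c: "c \<ge> 1" using t0 by (simp add: c_def)
  define e where "e = \<phi>0 / c"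
  have e: "e > 0" using \<phi>0 c by (simp add: e_def)
  define Z where "Z t x = exp (- L * t) * z t x - e * (x\<^sup>2 + 3 * t)" for t x
  have ec: "e * c = \<phi>0" using c by (simp add: e_def)
  have "Z t0 x0 = \<phi>0 - e * (c - 1)" by (simp add: Z_def \<phi>0_def c_def)
  also have "\<dots> = e" using ec by (simp add: algebra_simps)
  finally have Z0: "Z t0 x0 > 0" using e by simp
  \<comment> \<open>Beyond \<open>sqrt (M / e)\<close> the quadratic penalty is at least the bound
    \<open>M\<close>; including \<open>\<bar>x0\<bar>\<close> keeps the offending point in the
    rectangle, so the maximum found there is positive and hence global in \<open>x\<close>.\<close>
  define R where "R = max \<bar>x0\<bar> (sqrt (M / e))"
  have outside: "Z t x \<le> 0" if "t \<in> {0..T}" "\<bar>x\<bar> \<ge> R" for t x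
  proof -
    have "sqrt (M / e) \<le> \<bar>x\<bar>" using that by (simp add: R_def)
    then have "(sqrt (M / e))\<^sup>2 \<le> \<bar>x\<bar>\<^sup>2" using M e by (intro power_mono) auto
    then have "M / e \<le> x\<^sup>2" using M e by simp
    then have 1: "M \<le> e * x\<^sup>2" using e by (simp add: field_simps)
    have "exp (- L * t) * z t x \<le> exp (- L * t) * M"
      using bdd[OF that(1)] by (intro mult_left_mono) auto
    also have "\<dots> \<le> 1 * M"
      using L M that(1) by (intro mult_right_mono) auto
    finally have "exp (- L * t) * z t x \<le> e * x\<^sup>2" using 1 by simp
    moreover have "0 \<le> e * (3 * t)" using e that(1) by simp
    ultimately show ?thesis by (simp add: Z_def distrib_left)
  qed
  have contZ: "continuous_on ({0..T} \<times> {-R..R}) (\<lambda>p. Z (fst p) (snd p))"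
    unfolding Z_def
    by (intro continuous_intros continuous_on_subset[OF cont[unfolded case_prod_unfold]]) auto
  have "(t0, x0) \<in> {0..T} \<times> {-R..R}" using t0 by (auto simp: R_def)
  moreover have "compact ({0..T} \<times> {-R..R})" by (intro compact_Times) auto
  ultimately obtain p where p: "p \<in> {0..T} \<times> {-R..R}"
    "\<And>q. q \<in> {0..T} \<times> {-R..R} \<Longrightarrow> Z (fst q) (snd q) \<le> Z (fst p) (snd p)"
    using continuous_attains_sup[OF _ _ contZ] by blast
  obtain t1 x1 where p_eq: "p = (t1, x1)" by (cases p)
  have t1: "t1 \<in> {0..T}" using p(1) p_eq by auto
  have Z1: "Z t1 x1 > 0"
    using p(2)[of "(t0, x0)"] Z0 \<open>(t0, x0) \<in> _\<close> p_eq by auto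
  have max: "Z t x \<le> Z t1 x1" if "t \<in> {0..T}" for t x
  proof (cases "\<bar>x\<bar> \<ge> R")
    case True
    then show ?thesis using outside[OF that, of x] Z1 by linarith
  next
    case False
    then have "(t, x) \<in> {0..T} \<times> {-R..R}" using that by auto
    then show ?thesis using p(2)[of "(t, x)"] p_eq by simp
  qed
  have "Z 0 x1 \<le> 0" using init[of x1] e by (simp add: Z_def) (smt (verit) mult_nonneg_nonneg zero_le_power2)
  with Z1 t1 have t1': "t1 \<in> {0<..T}" by (cases "t1 = 0") auto
  \<comment> \<open>The differential inequality is assumed only where \<open>z\<close> is positive;
    since the penalty is nonnegative, a positive \<open>Z\<close> forces this.\<close>
  have zpos: "z t1 x1 > 0"
  proof (rule ccontr)
    assume "\<not> z t1 x1 > 0"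
    then have "exp (- L * t1) * z t1 x1 \<le> 0" by (intro mult_nonneg_nonpos) auto
    moreover have "0 \<le> e * (x1\<^sup>2 + 3 * t1)" using e t1 by simp
    ultimately show False using Z1 by (simp add: Z_def)
  qed
  define Zt where "Zt = exp (- L * t1) * (zt t1 x1 - L * z t1 x1) - 3 * e"
  have "((\<lambda>s. Z s x1) has_real_derivative Zt) (at t1)"
    unfolding Z_def Zt_def
    by (rule derivative_eq_intros refl dt[OF t1'])+ (simp add: algebra_simps)
  then have 1: "Zt \<ge> 0"
    by (rule derivative_nonneg_at_left_max[where a = 0]) (use t1' max in auto)
  \<comment> \<open>The penalty contributes \<open>3 * e\<close> to the time derivative but only
    \<open>2 * e\<close> to the second space derivative; the surplus \<open>e\<close> contradicts
    the inequality, whose zero-order term is absorbed by the factor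
    \<open>exp (- L * t)\<close>.\<close>
  have "exp (- L * t1) * zxx t1 x1 - 2 * e \<le> 0"
  proof (rule second_derivative_nonpos_at_max[where f = "Z t1" and x = x1])
    show "(Z t1 has_real_derivative exp (- L * t1) * zx t1 y - 2 * e * y) (at y)" for y
      unfolding Z_def
      by (rule derivative_eq_intros refl dx[OF t1'])+ (simp add: algebra_simps)
    show "((\<lambda>y. exp (- L * t1) * zx t1 y - 2 * e * y) has_real_derivative
        exp (- L * t1) * zxx t1 x1 - 2 * e) (at x1)"
      by (rule derivative_eq_intros refl dxx[OF t1'])+ (simp add: algebra_simps)
  qed (use max t1 in auto)
  with 1 have "exp (- L * t1) * (zt t1 x1 - L * z t1 x1 - zxx t1 x1) \<ge> e"
    by (simp add: Zt_def algebra_simps)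
  moreover have "exp (- L * t1) * (zt t1 x1 - L * z t1 x1 - zxx t1 x1) \<le> 0"
    using sub[OF t1' zpos] by (intro mult_nonneg_nonpos) auto
  ultimately show False using e by simp
qed

section \<open>One-sided Lipschitz bound and comparison for the equation\<close>

lemma log_nonlinearity_minus: "log_nonlinearity lam (- z) = - log_nonlinearity lam z"
  by (simp add: log_nonlinearity_def)

text \<open>The slope \<open>2 * lam * (ln \<bar>z\<bar> + 1)\<close> tends to minus infinity at 0
  but is bounded above for nonzero \<open>\<bar>z\<bar> \<le> M\<close>, which gives a bound from
  one side only. Nonnegative arguments are treated by hand, to avoid differentiating at 0; oddness
  gives the other signs.\<close>

lemma log_nonlinearity_one_sided_Lipschitz:
  assumes lam: "lam > 0" and M: "M \<ge> 1" and ab: "\<bar>a\<bar> \<le> M" "\<bar>b\<bar> \<le> M" "b \<le> a"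
  shows "log_nonlinearity lam a - log_nonlinearity lam b \<le> 2 * lam * (ln M + 1) * (a - b)"
proof -
  have nonneg: "log_nonlinearity lam a - log_nonlinearity lam b \<le> 2 * lam * (ln M + 1) * (a - b)"
    if ab: "a \<le> M" "b \<le> a" "0 \<le> b" for a b
  proof -
    have "a * ln a - b * ln b \<le> (ln M + 1) * (a - b)"
    proof (cases "b = 0")
      case True
      show ?thesis
      proof (cases "a = 0")
        case False
        then have "ln a \<le> ln M" using ab M by simp
        then have "a * ln a \<le> a * (ln M + 1)" using ab by (intro mult_left_mono) auto
        then show ?thesis using True by (simp add: mult.commute)
      qed (use True in simp)
    next
      case False
      then have b: "b > 0" "a > 0" using ab by auto
      \<comment> \<open>This controls the second summand of
        \<open>a * ln a - b * ln b = (a - b) * ln a + b * (ln a - ln b)\<close>; the first is at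
        most \<open>(a - b) * ln M\<close>.\<close>
      have "ln a - ln b \<le> (a - b) / b" using ln_diff_le b by blast
      then have 1: "b * (ln a - ln b) \<le> a - b" using b by (simp add: field_simps)
      have "(a - b) * ln a \<le> (a - b) * ln M" using ab b M by (intro mult_left_mono) auto
      with 1 show ?thesis by (simp add: algebra_simps)
    qed
    moreover have f: "log_nonlinearity lam z = 2 * lam * (z * ln z)" if "z \<ge> 0" for z
      using that by (auto simp: log_nonlinearity_def ln_realpow)
    ultimately show ?thesis using ab lam
      by (simp add: f right_diff_distrib[symmetric] mult.assoc)
  qed
  have f0: "log_nonlinearity lam 0 = 0" by (simp add: log_nonlinearity_def)
  consider "0 \<le> b" | "b < 0" "0 \<le> a" | "a < 0" by linarith
  then show ?thesis
  proof cases
    case 1 then show ?thesis using nonneg ab by auto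
  next
    case 2
    then show ?thesis
      using nonneg[of a 0] nonneg[of "- b" 0] ab f0
      by (simp add: log_nonlinearity_minus algebra_simps)
  next
    case 3
    then show ?thesis using nonneg[of "- b" "- a"] ab
      by (simp add: log_nonlinearity_minus algebra_simps)
  qed
qed

text \<open>Where \<open>u\<close> exceeds \<open>w\<close>, the one-sided Lipschitz bound turns the
  difference of the nonlinearities into a linear term, which is the form that
  \<open>parabolic_maximum_principle\<close> asks for, and only at such points.\<close>

lemma log_nonlinearity_comparison:
  fixes u ut ux uxx w wt wx wxx :: "real \<Rightarrow> real \<Rightarrow> real"
  assumes lam: "lam > 0"
    and cont: "continuous_on ({0..T} \<times> UNIV) (\<lambda>(t, x). u t x)"
      "continuous_on ({0..T} \<times> UNIV) (\<lambda>(t, x). w t x)"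
    and bdd: "\<And>t x. t \<in> {0..T} \<Longrightarrow> \<bar>u t x\<bar> \<le> M" "\<And>t x. t \<in> {0..T} \<Longrightarrow> \<bar>w t x\<bar> \<le> M"
    and init: "\<And>x. u 0 x \<le> w 0 x"
    and du: "\<And>t x. t \<in> {0<..T} \<Longrightarrow> ((\<lambda>s. u s x) has_real_derivative ut t x) (at t)"
      "\<And>t x. t \<in> {0<..T} \<Longrightarrow> ((\<lambda>y. u t y) has_real_derivative ux t x) (at x)"
      "\<And>t x. t \<in> {0<..T} \<Longrightarrow> ((\<lambda>y. ux t y) has_real_derivative uxx t x) (at x)"
    and dw: "\<And>t x. t \<in> {0<..T} \<Longrightarrow> ((\<lambda>s. w s x) has_real_derivative wt t x) (at t)"
      "\<And>t x. t \<in> {0<..T} \<Longrightarrow> ((\<lambda>y. w t y) has_real_derivative wx t x) (at x)"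
      "\<And>t x. t \<in> {0<..T} \<Longrightarrow> ((\<lambda>y. wx t y) has_real_derivative wxx t x) (at x)"
    and sub: "\<And>t x. t \<in> {0<..T} \<Longrightarrow> ut t x \<le> uxx t x + log_nonlinearity lam (u t x)"
    and super: "\<And>t x. t \<in> {0<..T} \<Longrightarrow> wt t x \<ge> wxx t x + log_nonlinearity lam (w t x)"
    and t0: "t0 \<in> {0..T}"
  shows "u t0 x0 \<le> w t0 x0"
proof -
  define N where "N = max M 1"
  have N: "\<bar>u t x\<bar> \<le> N" "\<bar>w t x\<bar> \<le> N" if "t \<in> {0..T}" for t x
    using bdd[OF that, of x] by (auto simp: N_def)
  have "u t0 x0 - w t0 x0 \<le> 0"
  proof (rule parabolic_maximum_principle[where z = "\<lambda>t x. u t x - w t x" and T = T and M = "2 * N"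
        and zt = "\<lambda>t x. ut t x - wt t x" and zx = "\<lambda>t x. ux t x - wx t x"
        and zxx = "\<lambda>t x. uxx t x - wxx t x" and L = "2 * lam * (ln N + 1)"])
    show "continuous_on ({0..T} \<times> UNIV) (\<lambda>(t, x). u t x - w t x)"
      using continuous_on_diff[OF cont] by (simp add: case_prod_unfold)
    show "u t x - w t x \<le> 2 * N" if "t \<in> {0..T}" for t x
      using N[OF that, of x] by linarith
    show "2 * lam * (ln N + 1) \<ge> 0" using lam by (simp add: N_def)
    show "ut t x - wt t x \<le> uxx t x - wxx t x + 2 * lam * (ln N + 1) * (u t x - w t x)"
      if "t \<in> {0<..T}" "u t x - w t x > 0" for t x
    proof -
      have "log_nonlinearity lam (u t x) - log_nonlinearity lam (w t x)
          \<le> 2 * lam * (ln N + 1) * (u t x - w t x)"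
        using N[of t x] that by (intro log_nonlinearity_one_sided_Lipschitz lam) (auto simp: N_def)
      then show ?thesis using sub[OF that(1), of x] super[OF that(1), of x] by linarith
    qed
  qed (use init du dw t0 in \<open>auto intro!: DERIV_diff\<close>)
  then show ?thesis by simp
qed

text \<open>The zero function solves the equation, thanks to the value 0 of the nonlinearity at 0,
  and serves as the subsolution.\<close>

lemma solution_nonneg:
  assumes lam: "lam > 0" and u: "solution_from lam u0 u" and u0: "\<And>x. u0 x \<ge> 0" and t: "t \<ge> 0"
  shows "u t x \<ge> 0"
proof -
  define T where "T = t + 1"
  have T: "T > 0" using t by (simp add: T_def)
  obtain ut ux uxx where d: "\<forall>t\<in>{0<..T}. \<forall>x.
      ((\<lambda>s. u s x) has_real_derivative ut t x) (at t) \<and>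
      ((\<lambda>y. u t y) has_real_derivative ux t x) (at x) \<and>
      ((\<lambda>y. ux t y) has_real_derivative uxx t x) (at x)"
    and eq: "\<forall>t\<in>{0<..T}. \<forall>x. ut t x = uxx t x + log_nonlinearity lam (u t x)"
    using u T unfolding solution_from_def by blast
  have cont: "continuous_on ({0..T} \<times> UNIV) (\<lambda>(t, x). u t x)"
    and "bounded ((\<lambda>(t, x). u t x) ` ({0..T} \<times> UNIV))"
    and init: "\<And>x. u 0 x = u0 x"
    using u T unfolding solution_from_def by blast+
  then obtain M where M: "\<And>t x. t \<in> {0..T} \<Longrightarrow> \<bar>u t x\<bar> \<le> M"
    unfolding bounded_iff by fastforce
  have "M \<ge> 0" using M[of 0 0] T by simp
  show ?thesis
    by (rule log_nonlinearity_comparison[OF lam, where u = "\<lambda>_ _. 0" and ut = "\<lambda>_ _. 0"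
          and ux = "\<lambda>_ _. 0" and uxx = "\<lambda>_ _. 0" and w = u and T = T and M = M
          and wt = ut and wx = ux and wxx = uxx])
       (use cont M \<open>M \<ge> 0\<close> init u0 d eq t in \<open>auto simp: log_nonlinearity_def[of _ 0] T_def case_prod_unfold\<close>)
qed

section \<open>Heat flow\<close>

text \<open>The mean value inequality bounds the difference quotients by \<open>w\<close> on the
  ball, so dominated convergence applies along every sequence tending to \<open>s0\<close>.\<close>

lemma has_real_derivative_lebesgue_integral:
  fixes f f' :: "real \<Rightarrow> 'a \<Rightarrow> real"
  assumes d: "d > 0"
    and int: "\<And>s. s \<in> ball s0 d \<Longrightarrow> integrable M (f s)"
    and der: "\<And>s y. s \<in> ball s0 d \<Longrightarrow> ((\<lambda>s. f s y) has_real_derivative f' s y) (at s)"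
    and bound: "\<And>s y. s \<in> ball s0 d \<Longrightarrow> \<bar>f' s y\<bar> \<le> w y"
    and w: "integrable M w"
    and meas: "f' s0 \<in> borel_measurable M"
  shows "((\<lambda>s. \<integral>y. f s y \<partial>M) has_real_derivative (\<integral>y. f' s0 y \<partial>M)) (at s0)"
  unfolding has_field_derivative_iff tendsto_at_iff_sequentially
proof (intro allI impI)
  fix X :: "nat \<Rightarrow> real"
  assume X: "\<forall>i. X i \<in> UNIV - {s0}" "X \<longlonglongrightarrow> s0"
  have s0: "s0 \<in> ball s0 d" using d by simp
  have "eventually (\<lambda>i. X i \<in> ball s0 d) sequentially"
    using X(2) d by (intro topological_tendstoD) auto
  then obtain N where N: "\<And>i. i \<ge> N \<Longrightarrow> X i \<in> ball s0 d"
    by (auto simp: eventually_sequentially)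
  \<comment> \<open>Discarding the first \<open>N\<close> terms keeps every sample point in the ball
    where the bound holds; the shift does not affect the limit.\<close>
  define Y where "Y i = X (i + N)" for i
  have Y: "Y i \<in> ball s0 d" "Y i \<noteq> s0" for i using N X(1) by (auto simp: Y_def)
  have Ylim: "Y \<longlonglongrightarrow> s0" unfolding Y_def using X(2) by (rule LIMSEQ_ignore_initial_segment)
  have "(\<lambda>i. \<integral>y. (f (Y i) y - f s0 y) / (Y i - s0) \<partial>M) \<longlonglongrightarrow> (\<integral>y. f' s0 y \<partial>M)"
  proof (rule integral_dominated_convergence[where w = w])
    show "(\<lambda>y. (f (Y i) y - f s0 y) / (Y i - s0)) \<in> borel_measurable M" for i
      using int[OF Y(1)[of i]] int[OF s0] by measurable
    show "AE y in M. (\<lambda>i. (f (Y i) y - f s0 y) / (Y i - s0)) \<longlonglongrightarrow> f' s0 y"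
    proof (intro AE_I2)
      fix y
      have "((\<lambda>s. (f s y - f s0 y) / (s - s0)) \<longlongrightarrow> f' s0 y) (at s0)"
        using der[OF s0] by (simp add: has_field_derivative_iff)
      then show "(\<lambda>i. (f (Y i) y - f s0 y) / (Y i - s0)) \<longlonglongrightarrow> f' s0 y"
        unfolding tendsto_at_iff_sequentially using Y(2) Ylim by (auto simp: comp_def)
    qed
    show "AE y in M. norm ((f (Y i) y - f s0 y) / (Y i - s0)) \<le> w y" for i
    proof (intro AE_I2)
      fix y
      have "norm (f (Y i) y - f s0 y) \<le> w y * norm (Y i - s0)"
        by (rule field_differentiable_bound[of "ball s0 d" "\<lambda>s. f s y" "\<lambda>s. f' s y"])
           (use der bound Y(1) s0 in \<open>auto intro: has_field_derivative_at_within\<close>)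
      then show "norm ((f (Y i) y - f s0 y) / (Y i - s0)) \<le> w y"
        using Y(2)[of i] by (simp add: field_simps)
    qed
  qed (use w meas in auto)
  moreover have "(\<integral>y. (f (Y i) y - f s0 y) / (Y i - s0) \<partial>M) =
      ((\<integral>y. f (Y i) y \<partial>M) - (\<integral>y. f s0 y \<partial>M)) / (Y i - s0)" for i
    by (simp only: integral_divide_zero Bochner_Integration.integral_diff[OF int[OF Y(1)[of i]] int[OF s0]])
  ultimately have "(\<lambda>i. ((\<integral>y. f (Y i) y \<partial>M) - (\<integral>y. f s0 y \<partial>M)) / (Y i - s0))
      \<longlonglongrightarrow> (\<integral>y. f' s0 y \<partial>M)" by (simp only:)
  then show "((\<lambda>s. ((\<integral>y. f s y \<partial>M) - (\<integral>y. f s0 y \<partial>M)) / (s - s0)) \<circ> X)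
      \<longlonglongrightarrow> (\<integral>y. f' s0 y \<partial>M)"
    unfolding comp_def Y_def by (rule LIMSEQ_offset)
qed

section \<open>The Gaussian kernel: derivatives and bounds\<close>

definition heat_kernel :: "real \<Rightarrow> real \<Rightarrow> real" where
  "heat_kernel t x = exp (- x\<^sup>2 / (4 * t)) / sqrt (4 * pi * t)"

definition heat_kernel_x :: "real \<Rightarrow> real \<Rightarrow> real" where
  "heat_kernel_x t x = - (x / (2 * t)) * heat_kernel t x"

definition heat_kernel_xx :: "real \<Rightarrow> real \<Rightarrow> real" where
  "heat_kernel_xx t x = (x\<^sup>2 / (4 * t\<^sup>2) - 1 / (2 * t)) * heat_kernel t x"

lemma heat_kernel_measurable [measurable]:
  "heat_kernel t \<in> borel_measurable borel"
  "heat_kernel_x t \<in> borel_measurable borel"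
  "heat_kernel_xx t \<in> borel_measurable borel"
  unfolding heat_kernel_def[abs_def] heat_kernel_x_def[abs_def] heat_kernel_xx_def[abs_def]
  by measurable

lemma heat_kernel_has_derivative_x:
  assumes "t > 0"
  shows "(heat_kernel t has_real_derivative heat_kernel_x t x) (at x)"
proof -
  have "((\<lambda>x. - x\<^sup>2 / (4 * t)) has_real_derivative - (x / (2 * t))) (at x)"
    using assms by (auto intro!: derivative_eq_intros)
  from DERIV_cdivide[OF DERIV_fun_exp[OF this], of "sqrt (4 * pi * t)"]
  show ?thesis unfolding heat_kernel_def[abs_def] heat_kernel_x_def by (simp add: mult.commute)
qed

lemma heat_kernel_x_has_derivative_x:
  assumes "t > 0"
  shows "(heat_kernel_x t has_real_derivative heat_kernel_xx t x) (at x)"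
proof -
  have "((\<lambda>x. - (x / (2 * t))) has_real_derivative - (1 / (2 * t))) (at x)"
    using assms by (auto intro!: derivative_eq_intros)
  from DERIV_mult[OF this heat_kernel_has_derivative_x[OF assms]]
  have "((\<lambda>x. - (x / (2 * t)) * heat_kernel t x) has_real_derivative
      (- (1 / (2 * t))) * heat_kernel t x + heat_kernel_x t x * - (x / (2 * t))) (at x)" .
  moreover have "(- (1 / (2 * t))) * heat_kernel t x + heat_kernel_x t x * - (x / (2 * t))
      = heat_kernel_xx t x"
    using assms unfolding heat_kernel_xx_def heat_kernel_x_def
    by (simp add: field_simps power2_eq_square)
  ultimately show ?thesis unfolding heat_kernel_x_def[abs_def] by (simp only:)
qed

text \<open>That \<open>heat_kernel_xx\<close> is also the time derivative is the heat equation for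
  the kernel, so no separate function is introduced for it.\<close>

lemma heat_kernel_has_derivative_t:
  assumes "t > 0"
  shows "((\<lambda>t. heat_kernel t x) has_real_derivative heat_kernel_xx t x) (at t)"
proof -
  have "((\<lambda>t. exp (- x\<^sup>2 / (4 * t))) has_real_derivative
      exp (- x\<^sup>2 / (4 * t)) * (x\<^sup>2 / (4 * t\<^sup>2))) (at t)"
    by (rule DERIV_fun_exp)
       (use assms in \<open>auto intro!: derivative_eq_intros simp: field_simps power2_eq_square\<close>)
  moreover have "((\<lambda>t. sqrt (4 * pi * t)) has_real_derivative
      sqrt (4 * pi * t) / (2 * t)) (at t)"
  proof -
    have "sqrt (4 * pi * t) * sqrt (4 * pi * t) = 4 * pi * t"
      using assms by (intro real_sqrt_mult_self[THEN trans]) simp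
    then have "inverse (sqrt (4 * pi * t)) / 2 * (4 * pi) = sqrt (4 * pi * t) / (2 * t)"
      using assms by (simp add: field_simps)
    moreover have "((\<lambda>t. sqrt (4 * pi * t)) has_real_derivative
        inverse (sqrt (4 * pi * t)) / 2 * (4 * pi)) (at t)"
      by (rule DERIV_chain2[OF DERIV_real_sqrt])
         (use assms in \<open>auto intro!: derivative_eq_intros\<close>)
    ultimately show ?thesis by simp
  qed
  ultimately have "((\<lambda>t. heat_kernel t x) has_real_derivative
      (exp (- x\<^sup>2 / (4 * t)) * (x\<^sup>2 / (4 * t\<^sup>2)) * sqrt (4 * pi * t)
        - exp (- x\<^sup>2 / (4 * t)) * (sqrt (4 * pi * t) / (2 * t)))
      / (sqrt (4 * pi * t) * sqrt (4 * pi * t))) (at t)"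
    unfolding heat_kernel_def[abs_def] by (rule DERIV_divide) (use assms in simp)
  moreover have "(E * A * S - E * (S / B)) / (S * S) = (A - 1 / B) * (E / S)"
    if "S \<noteq> 0" for E A B S :: real
    using that by (simp add: field_simps)
  moreover have "sqrt (4 * pi * t) \<noteq> 0" using assms by simp
  ultimately show ?thesis unfolding heat_kernel_xx_def heat_kernel_def by (simp only: not_False_eq_True)
qed

lemma heat_kernel_nonneg: "t > 0 \<Longrightarrow> heat_kernel t x \<ge> 0"
  by (simp add: heat_kernel_def)

lemma heat_kernel_le:
  assumes "t > 0" shows "heat_kernel t x \<le> 1 / sqrt (4 * pi * t)"
  unfolding heat_kernel_def using assms by (intro divide_right_mono) auto

lemma mult_exp_minus_le_1:
  fixes r :: real shows "r * exp (- r) \<le> 1"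
proof -
  have "r \<le> exp r" using exp_ge_add_one_self[of r] by linarith
  then show ?thesis by (simp add: exp_minus field_simps)
qed

text \<open>In terms of \<open>r = x\<^sup>2 / (4 * t)\<close> the factors in front of the Gaussian
  are bounded by affine functions of \<open>r\<close>, and both \<open>exp (- r)\<close> and
  \<open>r * exp (- r)\<close> are at most 1. Uniformity in \<open>t \<ge> a\<close> serves
  differentiation in \<open>t\<close> under the integral.\<close>

lemma heat_kernel_derivs_bound:
  assumes a: "a > 0" and t: "t \<ge> a"
  shows "\<bar>heat_kernel_x t x\<bar> \<le> (1 / (2 * a) + 2) / sqrt (4 * pi * a)"
    and "\<bar>heat_kernel_xx t x\<bar> \<le> (3 / (2 * a)) / sqrt (4 * pi * a)"
proof -
  define r where "r = x\<^sup>2 / (4 * t)"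
  have tpos: "t > 0" using assms by simp
  have r: "r \<ge> 0" using tpos by (simp add: r_def)
  have re: "r * exp (- r) \<le> 1" "exp (- r) \<le> 1" using mult_exp_minus_le_1 r by auto
  have s: "1 / sqrt (4 * pi * t) \<le> 1 / sqrt (4 * pi * a)"
    using assms by (intro divide_left_mono) auto
  have K: "heat_kernel t x = exp (- r) * (1 / sqrt (4 * pi * t))"
    by (simp add: heat_kernel_def r_def)
  have ta: "1 / t \<le> 1 / a" using assms by (simp add: frac_le)
  have "\<bar>x\<bar> \<le> 1 + x\<^sup>2"
    using zero_le_power2[of "\<bar>x\<bar> - 1"] zero_le_power2[of x] by (simp add: power2_eq_square algebra_simps)
  then have "\<bar>x\<bar> / (2 * t) \<le> (1 + x\<^sup>2) / (2 * t)" using tpos by (intro divide_right_mono) auto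
  also have "\<dots> = 1 / (2 * t) + 2 * r" using tpos by (simp add: r_def field_simps)
  finally have "\<bar>x\<bar> / (2 * t) * exp (- r) \<le> (1 / (2 * t) + 2 * r) * exp (- r)"
    by (intro mult_right_mono) auto
  also have "\<dots> = 1 / (2 * t) * exp (- r) + 2 * (r * exp (- r))" by (simp add: algebra_simps)
  also have "\<dots> \<le> 1 / (2 * t) * 1 + 2 * 1"
    using re tpos by (intro add_mono mult_left_mono) auto
  also have "\<dots> \<le> 1 / (2 * a) + 2" using ta by simp
  finally have "\<bar>x\<bar> / (2 * t) * exp (- r) * (1 / sqrt (4 * pi * t)) \<le> (1 / (2 * a) + 2) * (1 / sqrt (4 * pi * a))"
    by (rule mult_mono[OF _ s]) (use a tpos in auto)
  then show "\<bar>heat_kernel_x t x\<bar> \<le> (1 / (2 * a) + 2) / sqrt (4 * pi * a)"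
    using tpos by (simp add: heat_kernel_x_def K abs_mult)
  have "\<bar>x\<^sup>2 / (4 * t\<^sup>2) - 1 / (2 * t)\<bar> \<le> \<bar>x\<^sup>2 / (4 * t\<^sup>2)\<bar> + \<bar>1 / (2 * t)\<bar>" by (rule abs_triangle_ineq4)
  also have "\<dots> = (r + 1 / 2) * (1 / t)"
    using tpos by (simp add: r_def field_simps power2_eq_square)
  finally have "\<bar>x\<^sup>2 / (4 * t\<^sup>2) - 1 / (2 * t)\<bar> * exp (- r) \<le> (r + 1 / 2) * (1 / t) * exp (- r)"
    by (intro mult_right_mono) auto
  also have "\<dots> = (r * exp (- r) + 1 / 2 * exp (- r)) * (1 / t)" by (simp add: algebra_simps)
  also have "\<dots> \<le> (1 + 1 / 2 * 1) * (1 / a)"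
    using re ta tpos r by (intro mult_mono add_mono) auto
  finally have "\<bar>x\<^sup>2 / (4 * t\<^sup>2) - 1 / (2 * t)\<bar> * exp (- r) * (1 / sqrt (4 * pi * t))
      \<le> (1 + 1 / 2 * 1) * (1 / a) * (1 / sqrt (4 * pi * a))"
    by (rule mult_mono[OF _ s]) (use a tpos in auto)
  then show "\<bar>heat_kernel_xx t x\<bar> \<le> (3 / (2 * a)) / sqrt (4 * pi * a)"
    using tpos by (simp add: heat_kernel_xx_def K abs_mult)
qed

lemma integrable_mult_bounded:
  fixes f g :: "'a \<Rightarrow> real"
  assumes "integrable M f" "g \<in> borel_measurable M" "\<And>y. \<bar>g y\<bar> \<le> C"
  shows "integrable M (\<lambda>y. f y * g y)"
proof (rule Bochner_Integration.integrable_bound)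
  show "integrable M (\<lambda>y. C * \<bar>f y\<bar>)" using assms(1) by simp
  show "(\<lambda>y. f y * g y) \<in> borel_measurable M" using assms by measurable
  show "AE y in M. norm (f y * g y) \<le> norm (C * \<bar>f y\<bar>)"
  proof (intro AE_I2)
    fix y
    have "\<bar>f y\<bar> * \<bar>g y\<bar> \<le> \<bar>f y\<bar> * C" using assms(3)[of y] by (intro mult_left_mono) auto
    also have "\<dots> \<le> \<bar>C * \<bar>f y\<bar>\<bar>" by (simp add: mult.commute)
    finally show "norm (f y * g y) \<le> norm (C * \<bar>f y\<bar>)" by (simp add: abs_mult)
  qed
qed

text \<open>All three parts differentiate under the integral, with \<open>\<bar>f y\<bar>\<close>
  times a bound on the kernel derivative as dominating function.\<close>

lemma
  fixes f :: "real \<Rightarrow> real"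
  assumes f: "integrable lborel f" and t: "t > 0"
  shows heat_convolution_has_derivative_x:
      "((\<lambda>x. \<integral>y. f y * heat_kernel t (x - y) \<partial>lborel) has_real_derivative
        (\<integral>y. f y * heat_kernel_x t (x - y) \<partial>lborel)) (at x)"
    and heat_convolution_has_derivative_xx:
      "((\<lambda>x. \<integral>y. f y * heat_kernel_x t (x - y) \<partial>lborel) has_real_derivative
        (\<integral>y. f y * heat_kernel_xx t (x - y) \<partial>lborel)) (at x)"
    and heat_convolution_has_derivative_t:
      "((\<lambda>t. \<integral>y. f y * heat_kernel t (x - y) \<partial>lborel) has_real_derivative
        (\<integral>y. f y * heat_kernel_xx t (x - y) \<partial>lborel)) (at t)"
proof -
  have [measurable]: "f \<in> borel_measurable borel" using f by simp
  have K: "\<bar>heat_kernel t x\<bar> \<le> 1 / sqrt (4 * pi * t)" if "t > 0" for t x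
    using heat_kernel_le[OF that] heat_kernel_nonneg[OF that] by (simp add: abs_of_nonneg)
  define Cx where "Cx a = (1 / (2 * a) + 2) / sqrt (4 * pi * a)" for a :: real
  define Cxx where "Cxx a = (3 / (2 * a)) / sqrt (4 * pi * a)" for a :: real
  note Kx = heat_kernel_derivs_bound(1)[folded Cx_def]
  note Kxx = heat_kernel_derivs_bound(2)[folded Cxx_def]
  have chain: "((\<lambda>x. f y * g (x - y)) has_real_derivative f y * D (x - y)) (at x)"
    if "\<And>x. (g has_real_derivative D x) (at x)" for g D :: "real \<Rightarrow> real" and x y
  proof -
    have "((\<lambda>x. g (x - y)) has_real_derivative D (x - y) * 1) (at x)"
      by (rule DERIV_chain'[OF _ that, where f = "\<lambda>x. x - y"]) (auto intro!: derivative_eq_intros)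
    then show ?thesis by (auto intro: DERIV_cmult)
  qed
  have bd: "\<bar>f y * k\<bar> \<le> \<bar>f y\<bar> * C" if "\<bar>k\<bar> \<le> C" for y k C
    using that by (simp add: abs_mult mult_left_mono)
  show "((\<lambda>x. \<integral>y. f y * heat_kernel t (x - y) \<partial>lborel) has_real_derivative
        (\<integral>y. f y * heat_kernel_x t (x - y) \<partial>lborel)) (at x)"
  proof (rule has_real_derivative_lebesgue_integral[where d = 1 and w = "\<lambda>y. \<bar>f y\<bar> * Cx t"])
    show "integrable lborel (\<lambda>y. f y * heat_kernel t (s - y))" for s
      by (rule integrable_mult_bounded[OF f _ K[OF t]]) measurable
    show "((\<lambda>s. f y * heat_kernel t (s - y)) has_real_derivative f y * heat_kernel_x t (s - y)) (at s)" for s y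
      by (rule chain[OF heat_kernel_has_derivative_x[OF t]])
    show "\<bar>f y * heat_kernel_x t (s - y)\<bar> \<le> \<bar>f y\<bar> * Cx t" for s y
      by (rule bd[OF Kx[OF t order_refl]])
  qed (use f in auto)
  show "((\<lambda>x. \<integral>y. f y * heat_kernel_x t (x - y) \<partial>lborel) has_real_derivative
        (\<integral>y. f y * heat_kernel_xx t (x - y) \<partial>lborel)) (at x)"
  proof (rule has_real_derivative_lebesgue_integral[where d = 1 and w = "\<lambda>y. \<bar>f y\<bar> * Cxx t"])
    show "integrable lborel (\<lambda>y. f y * heat_kernel_x t (s - y))" for s
      by (rule integrable_mult_bounded[OF f _ Kx[OF t order_refl]]) measurable
    show "((\<lambda>s. f y * heat_kernel_x t (s - y)) has_real_derivative f y * heat_kernel_xx t (s - y)) (at s)" for s y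
      by (rule chain[OF heat_kernel_x_has_derivative_x[OF t]])
    show "\<bar>f y * heat_kernel_xx t (s - y)\<bar> \<le> \<bar>f y\<bar> * Cxx t" for s y
      by (rule bd[OF Kxx[OF t order_refl]])
  qed (use f in auto)
  show "((\<lambda>t. \<integral>y. f y * heat_kernel t (x - y) \<partial>lborel) has_real_derivative
        (\<integral>y. f y * heat_kernel_xx t (x - y) \<partial>lborel)) (at t)"
  \<comment> \<open>On the ball of radius \<open>t / 2\<close> all times are at least
    \<open>t / 2\<close>, where one constant bounds \<open>heat_kernel_xx\<close>.\<close>
  proof (rule has_real_derivative_lebesgue_integral[where d = "t / 2" and w = "\<lambda>y. \<bar>f y\<bar> * Cxx (t / 2)"])
    fix s y assume "s \<in> ball t (t / 2)"
    then have s: "s > 0" "s \<ge> t / 2" using t by (auto simp: dist_real_def abs_if split: if_splits)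
    show "integrable lborel (\<lambda>y. f y * heat_kernel s (x - y))"
      by (rule integrable_mult_bounded[OF f _ K[OF s(1)]]) measurable
    show "((\<lambda>s. f y * heat_kernel s (x - y)) has_real_derivative f y * heat_kernel_xx s (x - y)) (at s)"
      by (rule DERIV_cmult[OF heat_kernel_has_derivative_t[OF s(1)]])
    show "\<bar>f y * heat_kernel_xx s (x - y)\<bar> \<le> \<bar>f y\<bar> * Cxx (t / 2)"
      by (rule bd[OF Kxx]) (use t s in auto)
  qed (use f t in auto)
qed

section \<open>The heat flow and its pointwise bounds\<close>

text \<open>With the Gaussian rescaled to unit variance, continuity up to \<open>t = 0\<close> follows from dominated
  convergence; for \<open>t > 0\<close> the substitution \<open>y = x + sqrt (2 * t) * z\<close> gives the convolution with
  the heat kernel.\<close>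

definition heat_flow :: "(real \<Rightarrow> real) \<Rightarrow> real \<Rightarrow> real \<Rightarrow> real" where
  "heat_flow f t x = (\<integral>z. f (x + sqrt (2 * t) * z) * std_normal_density z \<partial>lborel)"

lemma heat_flow_0 [simp]: "heat_flow f 0 x = f x"
  by (simp add: heat_flow_def)

lemma heat_flow_eq_convolution:
  assumes "t > 0"
  shows "heat_flow f t x = (\<integral>y. f y * heat_kernel t (x - y) \<partial>lborel)"
proof -
  have "sqrt (2 * t) * heat_kernel t (- (sqrt (2 * t) * z)) = std_normal_density z" for z
  proof -
    have "sqrt (4 * pi * t) = sqrt (2 * t) * sqrt (2 * pi)"
      by (simp add: real_sqrt_mult[symmetric])
    then show ?thesis
      using assms by (simp add: heat_kernel_def std_normal_density_def power_mult_distrib)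
  qed
  then have "std_normal_density z = sqrt (2 * t) * heat_kernel t (x - (x + sqrt (2 * t) * z))" for z
    by simp
  then have "heat_flow f t x =
      \<bar>sqrt (2 * t)\<bar> *\<^sub>R (\<integral>z. f (x + sqrt (2 * t) * z) * heat_kernel t (x - (x + sqrt (2 * t) * z)) \<partial>lborel)"
    unfolding heat_flow_def using assms by (simp flip: integral_mult_right_zero add: ac_simps)
  also have "\<dots> = (\<integral>y. f y * heat_kernel t (x - y) \<partial>lborel)"
    using assms by (intro lborel_integral_real_affine[symmetric]) auto
  finally show ?thesis .
qed

lemma integrable_heat_flow:
  assumes "f \<in> borel_measurable borel" "\<And>x. \<bar>f x\<bar> \<le> M"
  shows "integrable lborel (\<lambda>z. f (x + sqrt (2 * t) * z) * std_normal_density z)"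
proof -
  have "integrable lborel (\<lambda>z. std_normal_density z * f (x + sqrt (2 * t) * z))"
    using assms by (intro integrable_mult_bounded) auto
  then show ?thesis by (simp add: mult.commute)
qed

lemma continuous_on_heat_flow:
  assumes f: "continuous_on UNIV f" and M: "\<And>x. \<bar>f x\<bar> \<le> M"
  shows "continuous_on S (\<lambda>(t, x). heat_flow f t x)"
proof (rule continuous_on_sequentiallyI)
  fix p :: "nat \<Rightarrow> real \<times> real" and a assume p: "p \<longlonglongrightarrow> a"
  have [measurable]: "f \<in> borel_measurable borel" using f by (rule borel_measurable_continuous_onI)
  have "(\<lambda>n. heat_flow f (fst (p n)) (snd (p n))) \<longlonglongrightarrow> heat_flow f (fst a) (snd a)"
    unfolding heat_flow_def
  proof (rule integral_dominated_convergence[where w = "\<lambda>z. M * std_normal_density z"])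
    show "AE z in lborel. (\<lambda>n. f (snd (p n) + sqrt (2 * fst (p n)) * z) * std_normal_density z)
        \<longlonglongrightarrow> f (snd a + sqrt (2 * fst a) * z) * std_normal_density z"
    proof (intro AE_I2 tendsto_mult tendsto_const)
      fix z
      have "(\<lambda>n. snd (p n) + sqrt (2 * fst (p n)) * z) \<longlonglongrightarrow> snd a + sqrt (2 * fst a) * z"
        by (intro tendsto_intros p)
      then show "(\<lambda>n. f (snd (p n) + sqrt (2 * fst (p n)) * z)) \<longlonglongrightarrow> f (snd a + sqrt (2 * fst a) * z)"
        by (rule continuous_on_tendsto_compose[OF f]) auto
    qed
  qed (use M in \<open>auto simp: abs_mult intro!: mult_right_mono\<close>)
  then show "(\<lambda>n. case p n of (t, x) \<Rightarrow> heat_flow f t x) \<longlonglongrightarrow> (case a of (t, x) \<Rightarrow> heat_flow f t x)"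
    by (simp add: case_prod_unfold)
qed

lemma heat_flow_nonneg:
  assumes "\<And>x. f x \<ge> 0" shows "heat_flow f t x \<ge> 0"
  unfolding heat_flow_def using assms by (intro integral_nonneg_AE AE_I2) auto

lemma heat_flow_le_sup:
  assumes "f \<in> borel_measurable borel" "\<And>x. f x \<ge> 0" "\<And>x. f x \<le> M"
  shows "heat_flow f t x \<le> M"
proof -
  have "heat_flow f t x \<le> (\<integral>z. M * std_normal_density z \<partial>lborel)"
    unfolding heat_flow_def using assms
    by (intro integral_mono integrable_heat_flow[of _ M] mult_right_mono)
       (auto simp: abs_of_nonneg intro: order_trans)
  then show ?thesis by simp
qed

text \<open>The kernel never exceeds its height \<open>1 / sqrt (4 * pi * t)\<close> at the origin,
  which therefore multiplies the total mass.\<close>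

lemma heat_flow_le_L1:
  assumes f: "integrable lborel f" "\<And>x. f x \<ge> 0" and t: "t > 0"
  shows "heat_flow f t x \<le> L1_norm f / sqrt (4 * pi * t)"
proof -
  have "(\<integral>y. f y * heat_kernel t (x - y) \<partial>lborel) \<le> (\<integral>y. f y * (1 / sqrt (4 * pi * t)) \<partial>lborel)"
  proof (rule integral_mono)
    show "integrable lborel (\<lambda>y. f y * heat_kernel t (x - y))"
      using heat_kernel_le[OF t] heat_kernel_nonneg[OF t]
      by (intro integrable_mult_bounded[OF f(1)]) (auto simp: abs_of_nonneg)
    show "f y * heat_kernel t (x - y) \<le> f y * (1 / sqrt (4 * pi * t))" for y
      by (rule mult_left_mono[OF heat_kernel_le[OF t] f(2)])
  qed (use f in auto)
  also have "\<dots> = (\<integral>y. f y \<partial>lborel) * (1 / sqrt (4 * pi * t))"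
    by (rule integral_mult_left_zero)
  finally show ?thesis using f(2)
    by (simp add: heat_flow_eq_convolution[OF t] L1_norm_def abs_of_nonneg)
qed

text \<open>The essential supremum bounds only almost every value; by continuity the set where the
  bound holds is closed, and a closed set of full measure is the whole line.\<close>

lemma Linf_norm_upper:
  assumes f: "continuous_on UNIV f" and bdd: "bounded (range f)"
  shows "\<bar>f x\<bar> \<le> Linf_norm f"
proof -
  have [measurable]: "f \<in> borel_measurable borel" using f by (rule borel_measurable_continuous_onI)
  obtain B where B: "\<And>x. \<bar>f x\<bar> \<le> B" using bdd by (auto simp: bounded_iff)
  define e where "e = esssup lborel (\<lambda>x. ereal \<bar>f x\<bar>)"
  have AE: "AE x in lborel. ereal \<bar>f x\<bar> \<le> e" unfolding e_def by (rule esssup_AE)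
  have "e \<le> ereal B" unfolding e_def using B by (intro esssup_I) auto
  have "closed {x. ereal \<bar>f x\<bar> \<le> e}"
    using f by (intro closed_Collect_le continuous_intros) auto
  then have *: "ereal \<bar>f x\<bar> \<le> e" for x
    using mem_closed_if_AE_lebesgue[of "{x. ereal \<bar>f x\<bar> \<le> e}" x] AE_completion[OF AE] by simp
  \<comment> \<open>\<open>real_of_ereal\<close> sends infinite values to 0: the bound
    \<open>B\<close> excludes plus infinity, the pointwise bound excludes minus infinity.\<close>
  show ?thesis using *[of x] \<open>e \<le> ereal B\<close> unfolding Linf_norm_def e_def[symmetric]
    by (cases e) auto
qed

lemma L1_norm_pos:
  assumes f: "continuous_on UNIV f" "integrable lborel f" and x: "f x \<noteq> 0"
  shows "L1_norm f > 0"
proof (rule ccontr)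
  assume "\<not> L1_norm f > 0"
  moreover have "(\<integral>x. \<bar>f x\<bar> \<partial>lborel) \<ge> 0" by (rule integral_nonneg_AE) simp
  ultimately have "(\<integral>x. \<bar>f x\<bar> \<partial>lborel) = 0" by (simp add: L1_norm_def)
  then have AE: "AE x in lborel. f x = 0"
    using integral_nonneg_eq_0_iff_AE[of lborel "\<lambda>x. \<bar>f x\<bar>"] f(2) by simp
  have "closed {x. f x = 0}"
    using f(1) by (intro closed_Collect_eq continuous_intros) auto
  then show False
    using mem_closed_if_AE_lebesgue[of "{x. f x = 0}" x] AE_completion[OF AE] x by simp
qed

section \<open>Decay exponent\<close>

lemma crossover_time_pos:
  assumes "m_inf > 0" "m1 > 0" shows "crossover_time m_inf m1 > 0"
  using assms by (simp add: crossover_time_def)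

text \<open>At \<open>\<tau>\<close> the two bounds coincide, so
  \<open>m1 / sqrt (4 * pi * t)\<close> is \<open>m_inf * (sqrt \<tau> / sqrt t)\<close> for
  positive \<open>t\<close>. With \<open>max\<close> both regimes fit one formula, and
  \<open>t = 0\<close> falls under the first.\<close>

lemma ln_heat_bound:
  assumes m: "m_inf > 0" "m1 > 0" and t: "t \<ge> 0" and \<tau>: "\<tau> = crossover_time m_inf m1"
  shows "ln (heat_bound m_inf m1 t) = ln m_inf + ln \<tau> / 2 - ln (max t \<tau>) / 2"
proof -
  have \<tau>pos: "\<tau> > 0" using crossover_time_pos[OF m] \<tau> by simp
  have s: "sqrt \<tau> = m1 / (sqrt (4 * pi) * m_inf)"
    using m unfolding \<tau> crossover_time_def by simp
  have h: "m1 / sqrt (4 * pi * t) = m_inf * (sqrt \<tau> / sqrt t)"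
    using m by (simp add: s real_sqrt_mult)
  show ?thesis
  proof (cases "t \<le> \<tau>")
    case True
    then have "heat_bound m_inf m1 t = m_inf"
    proof (cases "t = 0")
      case False
      then have "1 \<le> sqrt \<tau> / sqrt t" using True t by simp
      then have "m_inf * 1 \<le> m_inf * (sqrt \<tau> / sqrt t)" using m by (intro mult_left_mono) auto
      then show ?thesis using False by (simp add: heat_bound_def h)
    qed (simp add: heat_bound_def)
    then show ?thesis using True by (simp add: max_def)
  next
    case False
    then have tpos: "t > 0" using \<tau>pos by simp
    then have "sqrt \<tau> / sqrt t \<le> 1" using False by simp
    then have "m_inf * (sqrt \<tau> / sqrt t) \<le> m_inf" using m by (intro mult_left_le) auto
    then have "heat_bound m_inf m1 t = m_inf * (sqrt \<tau> / sqrt t)"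
      using tpos by (simp add: heat_bound_def h)
    then show ?thesis using False m tpos \<tau>pos by (simp add: ln_mult ln_div ln_sqrt)
  qed
qed

text \<open>For \<open>s \<ge> 0\<close> and \<open>\<tau>\<close> the crossover time this is
  \<open>2 * lam * exp (- 2 * lam * s) * ln (heat_bound m_inf m1 s)\<close>, written through
  \<open>max\<close> so that continuity on the whole line is evident.\<close>

definition decay_rate :: "real \<Rightarrow> real \<Rightarrow> real \<Rightarrow> real \<Rightarrow> real" where
  "decay_rate lam m_inf \<tau> s =
     2 * lam * exp (- 2 * lam * s) * (ln m_inf + ln \<tau> / 2 - ln (max s \<tau>) / 2)"

definition decay_exponent :: "real \<Rightarrow> real \<Rightarrow> real \<Rightarrow> real \<Rightarrow> real" where
  "decay_exponent lam m_inf \<tau> t = integral {0..t} (decay_rate lam m_inf \<tau>)"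

lemma continuous_on_decay_rate:
  assumes "\<tau> > 0" shows "continuous_on S (decay_rate lam m_inf \<tau>)"
  unfolding decay_rate_def[abs_def] using assms by (intro continuous_intros) auto

lemma decay_exponent_has_derivative:
  assumes "\<tau> > 0" "t > 0"
  shows "(decay_exponent lam m_inf \<tau> has_real_derivative decay_rate lam m_inf \<tau> t) (at t)"
proof -
  \<comment> \<open>The right endpoint \<open>t + 1\<close> makes \<open>t\<close> interior, so the
    derivative within the interval is two-sided.\<close>
  have "(decay_exponent lam m_inf \<tau> has_real_derivative decay_rate lam m_inf \<tau> t) (at t within {0..t + 1})"
    unfolding decay_exponent_def[abs_def] using assms
    by (intro integral_has_real_derivative continuous_on_decay_rate) auto
  moreover have "at t within {0..t + 1} = at t" using assms by (intro at_within_interior) simp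
  ultimately show ?thesis by simp
qed

lemma continuous_on_decay_exponent:
  assumes "\<tau> > 0" shows "continuous_on {0..T} (decay_exponent lam m_inf \<tau>)"
  unfolding decay_exponent_def[abs_def]
  by (intro indefinite_integral_continuous_1 integrable_continuous_real continuous_on_decay_rate assms)

text \<open>Half of the exponential decay is spent on the logarithm: on this half-line
  \<open>\<bar>ln s\<bar> \<le> s + \<bar>ln \<tau>\<bar>\<close>, and
  \<open>s * lam * exp (- (s * lam)) \<le> 1\<close>. The other half remains as an integrable
  majorant.\<close>

lemma set_integrable_exp_ln:
  fixes lam \<tau> :: real
  assumes lam: "lam > 0" and \<tau>: "\<tau> > 0"
  shows "set_integrable lborel {\<tau>..} (\<lambda>s. lam * exp (- 2 * lam * s) * ln s)"
proof (rule set_integrable_bound)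
  have "set_integrable lborel {\<tau>..} (\<lambda>s. exp (- (s * lam)))"
    by (rule set_integrable_subset[OF integrable_I0i_exp_mscale[OF lam]]) (use \<tau> in auto)
  then show "set_integrable lborel {\<tau>..} (\<lambda>s. (1 + lam * \<bar>ln \<tau>\<bar>) * exp (- (s * lam)))"
    by (rule set_integrable_mult_right)
  show "set_borel_measurable lborel {\<tau>..} (\<lambda>s. lam * exp (- 2 * lam * s) * ln s)"
    unfolding set_borel_measurable_def by measurable
  show "AE s in lborel. s \<in> {\<tau>..} \<longrightarrow>
      norm (lam * exp (- 2 * lam * s) * ln s) \<le> norm ((1 + lam * \<bar>ln \<tau>\<bar>) * exp (- (s * lam)))"
  proof (intro AE_I2 impI)
    fix s assume "s \<in> {\<tau>..}"
    then have s: "s \<ge> \<tau>" "s > 0" using \<tau> by auto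
    have "ln s \<le> s" using ln_le_minus_one[of s] s by simp
    moreover have "ln \<tau> \<le> ln s" using s \<tau> by simp
    ultimately have ln: "\<bar>ln s\<bar> \<le> s + \<bar>ln \<tau>\<bar>" using s by linarith
    have E: "exp (- 2 * lam * s) = exp (- (s * lam)) * exp (- (s * lam))"
      by (simp add: exp_add[symmetric])
    have "lam * exp (- 2 * lam * s) * \<bar>ln s\<bar> \<le> lam * exp (- 2 * lam * s) * (s + \<bar>ln \<tau>\<bar>)"
      using ln lam by (intro mult_left_mono) auto
    also have "\<dots> = exp (- (s * lam)) * ((s * lam) * exp (- (s * lam)) + lam * \<bar>ln \<tau>\<bar> * exp (- (s * lam)))"
      unfolding E by (simp add: algebra_simps)
    also have "\<dots> \<le> exp (- (s * lam)) * (1 + lam * \<bar>ln \<tau>\<bar> * 1)"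
      using s lam by (intro mult_left_mono add_mono mult_exp_minus_le_1) auto
    finally show "norm (lam * exp (- 2 * lam * s) * ln s) \<le> norm ((1 + lam * \<bar>ln \<tau>\<bar>) * exp (- (s * lam)))"
      using lam by (simp add: abs_mult mult.commute)
  qed
qed

text \<open>The rate is integrated in closed form up to \<open>\<tau>\<close>; afterwards only its
  \<open>ln s\<close> part is left as an integral. The boundary terms
  \<open>ln m_inf * exp (- 2 * lam * \<tau>)\<close> from the two sides of \<open>\<tau>\<close>
  cancel, leaving the term with \<open>ln (sqrt \<tau>)\<close>.\<close>

lemma decay_exponent_tendsto:
  assumes lam: "lam > 0" and \<tau>: "\<tau> > 0"
  shows "(decay_exponent lam m_inf \<tau> \<longlongrightarrow> psi_inf lam m_inf \<tau>) at_top"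
proof -
  \<comment> \<open>For the crossover time this is \<open>ln (m1 / sqrt (4 * pi))\<close>, the part
    of the logarithm of the bound after \<open>\<tau>\<close> that does not depend on time.\<close>
  define c where "c = ln m_inf + ln \<tau> / 2"
  define g where "g s = lam * exp (- 2 * lam * s) * ln s" for s
  have int_exp: "((\<lambda>s. 2 * lam * exp (- 2 * lam * s) * k) has_integral
      (k * exp (- 2 * lam * a) - k * exp (- 2 * lam * b))) {a..b}" if "a \<le> b" for a b k
  proof -
    have "((\<lambda>s. 2 * lam * exp (- 2 * lam * s) * k) has_integral
        (- k * exp (- 2 * lam * b) - - k * exp (- 2 * lam * a))) {a..b}"
      by (rule fundamental_theorem_of_calculus[OF that])
         (auto simp: has_real_derivative_iff_has_vector_derivative[symmetric] intro!: derivative_eq_intros)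
    then show ?thesis by (simp add: algebra_simps)
  qed
  have set_int: "set_integrable lborel {\<tau>..} g"
    using set_integrable_exp_ln[OF lam \<tau>] by (simp add: g_def[abs_def])
  have g_int: "set_integrable lborel {\<tau>..t} g" for t
    by (rule set_integrable_subset[OF set_int]) auto
  have formula: "decay_exponent lam m_inf \<tau> t = (ln m_inf - ln m_inf * exp (- 2 * lam * \<tau>))
      + (c * exp (- 2 * lam * \<tau>) - c * exp (- 2 * lam * t) - (LINT s:{\<tau>..t}|lborel. g s))"
    if t: "t \<ge> \<tau>" for t
  proof -
    have "(decay_rate lam m_inf \<tau> has_integral
        (ln m_inf * exp (- 2 * lam * 0) - ln m_inf * exp (- 2 * lam * \<tau>))) {0..\<tau>}"
      by (rule has_integral_eq[OF _ int_exp]) (use \<tau> in \<open>auto simp: decay_rate_def max_def\<close>)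
    moreover have "(decay_rate lam m_inf \<tau> has_integral
        (c * exp (- 2 * lam * \<tau>) - c * exp (- 2 * lam * t) - (LINT s:{\<tau>..t}|lborel. g s))) {\<tau>..t}"
    proof (rule has_integral_eq)
      show "((\<lambda>s. 2 * lam * exp (- 2 * lam * s) * c - g s) has_integral
        (c * exp (- 2 * lam * \<tau>) - c * exp (- 2 * lam * t) - (LINT s:{\<tau>..t}|lborel. g s))) {\<tau>..t}"
        using int_exp[OF t] set_borel_integral_eq_integral[OF g_int[of t]]
        by (intro has_integral_diff) (auto simp: has_integral_integral[symmetric])
      show "2 * lam * exp (- 2 * lam * s) * c - g s = decay_rate lam m_inf \<tau> s" if "s \<in> {\<tau>..t}" for s
        using that by (simp add: decay_rate_def g_def c_def max_absorb1 algebra_simps)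
    qed
    ultimately have "(decay_rate lam m_inf \<tau> has_integral
        (ln m_inf * exp (- 2 * lam * 0) - ln m_inf * exp (- 2 * lam * \<tau>)) +
        (c * exp (- 2 * lam * \<tau>) - c * exp (- 2 * lam * t) - (LINT s:{\<tau>..t}|lborel. g s))) {0..t}"
      using \<tau> t by (intro has_integral_combine[of 0 \<tau> t]) auto
    then show ?thesis unfolding decay_exponent_def by (simp add: integral_unique)
  qed
  have "((\<lambda>t. exp (- 2 * lam * t)) \<longlongrightarrow> 0) at_top"
    using lam by real_asymp
  moreover have "((\<lambda>t. LINT s:{\<tau>..t}|lborel. g s) \<longlongrightarrow> (LINT s:{\<tau>..}|lborel. g s)) at_top"
    by (rule tendsto_set_lebesgue_integral_at_top[OF _ set_int]) auto
  ultimately have "((\<lambda>t. (ln m_inf - ln m_inf * exp (- 2 * lam * \<tau>))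
      + (c * exp (- 2 * lam * \<tau>) - c * exp (- 2 * lam * t) - (LINT s:{\<tau>..t}|lborel. g s))) \<longlongrightarrow>
      (ln m_inf - ln m_inf * exp (- 2 * lam * \<tau>))
      + (c * exp (- 2 * lam * \<tau>) - c * 0 - (LINT s:{\<tau>..}|lborel. g s))) at_top"
    by (intro tendsto_intros)
  moreover have "(ln m_inf - ln m_inf * exp (- 2 * lam * \<tau>))
      + (c * exp (- 2 * lam * \<tau>) - c * 0 - (LINT s:{\<tau>..}|lborel. g s)) = psi_inf lam m_inf \<tau>"
    using \<tau> by (simp add: psi_inf_def c_def g_def ln_sqrt algebra_simps)
  ultimately have "((\<lambda>t. (ln m_inf - ln m_inf * exp (- 2 * lam * \<tau>))
      + (c * exp (- 2 * lam * \<tau>) - c * exp (- 2 * lam * t) - (LINT s:{\<tau>..t}|lborel. g s))) \<longlongrightarrow>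
      psi_inf lam m_inf \<tau>) at_top" by (simp only:)
  then show ?thesis
    by (rule Lim_transform_eventually) (use formula in \<open>auto simp: eventually_at_top_linorder intro!: exI[of _ \<tau>]\<close>)
qed

section \<open>The supersolution and the decay estimate\<close>

theorem theorem5p2:
  fixes lam m_inf m1 \<tau> :: real
    and u0 :: "real \<Rightarrow> real"
    and u :: "real \<Rightarrow> real \<Rightarrow> real"
  assumes "lam > 0"
    and "u0 \<in> BPC2"
    and "integrable lborel u0"
    and "\<forall>x. u0 x \<ge> 0"
    and "\<exists>x. u0 x \<noteq> 0"
    and "m_inf = Linf_norm u0"
    and "m1 = L1_norm u0"
    and "\<tau> = crossover_time m_inf m1"
    and "psi_inf lam m_inf \<tau> < 0"
    and "solution_from lam u0 u"
  shows "\<exists>\<psi> :: real \<Rightarrow> real.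
    (\<psi> \<longlongrightarrow> psi_inf lam m_inf \<tau>) at_top \<and>
    (\<forall>t\<ge>0. \<forall>x.
       0 \<le> u t x \<and>
       u t x \<le> heat_bound m_inf m1 t * exp (\<psi> t * exp (2 * lam * t)))"
proof -
  note lam = assms(1) and u = assms(10)
  have u0: "continuous_on UNIV u0" "bounded (range u0)" using assms(2) by (auto simp: BPC2_def)
  have nonneg: "u0 x \<ge> 0" for x using assms(4) by simp
  have le: "u0 x \<le> m_inf" for x
    using Linf_norm_upper[OF u0, of x] assms(6) by simp
  have abs: "\<bar>u0 x\<bar> \<le> m_inf" for x using le nonneg by simp
  obtain y where y: "u0 y \<noteq> 0" using assms(5) by blast
  have m: "m_inf > 0" "m1 > 0"
    using y nonneg[of y] le[of y] L1_norm_pos[OF u0(1) assms(3) y] assms(7) by auto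
  have \<tau>: "\<tau> > 0" using crossover_time_pos[OF m] assms(8) by simp
  have meas: "u0 \<in> borel_measurable borel" using u0(1) by (rule borel_measurable_continuous_onI)
  define v where "v = heat_flow u0"
  define vx where "vx t x = (\<integral>y. u0 y * heat_kernel_x t (x - y) \<partial>lborel)" for t x
  define vxx where "vxx t x = (\<integral>y. u0 y * heat_kernel_xx t (x - y) \<partial>lborel)" for t x
  define \<psi> where "\<psi> = decay_exponent lam m_inf \<tau>"
  define E where "E t = exp (\<psi> t * exp (2 * lam * t))" for t
  have v_nonneg: "v t x \<ge> 0" for t x unfolding v_def by (rule heat_flow_nonneg[OF nonneg])
  have v_le: "v t x \<le> heat_bound m_inf m1 t" if "t \<ge> 0" for t x
    using heat_flow_le_sup[OF meas nonneg le, of t x] heat_flow_le_L1[OF assms(3) nonneg, of t x] that assms(7)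
    by (auto simp: v_def heat_bound_def)
  have vd: "((\<lambda>y. v t y) has_real_derivative vx t x) (at x)"
    "((\<lambda>y. vx t y) has_real_derivative vxx t x) (at x)"
    "((\<lambda>s. v s x) has_real_derivative vxx t x) (at t)" if t: "t > 0" for t x
  proof -
    show "((\<lambda>y. v t y) has_real_derivative vx t x) (at x)"
      using heat_convolution_has_derivative_x[OF assms(3) t]
      by (simp add: v_def vx_def heat_flow_eq_convolution[OF t])
    show "((\<lambda>y. vx t y) has_real_derivative vxx t x) (at x)"
      using heat_convolution_has_derivative_xx[OF assms(3) t] by (simp add: vx_def vxx_def)
    \<comment> \<open>The convolution formula is available only at positive times, so it is
      substituted on a neighbourhood of \<open>t\<close> before differentiating in time.\<close>
    have "eventually (\<lambda>s. s > 0) (nhds t)"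
      using t by (intro eventually_nhds_in_open[of "{0<..}", simplified]) auto
    then have "eventually (\<lambda>s. v s x = (\<integral>y. u0 y * heat_kernel s (x - y) \<partial>lborel)) (nhds t)"
      by (rule eventually_mono) (simp add: v_def heat_flow_eq_convolution)
    then show "((\<lambda>s. v s x) has_real_derivative vxx t x) (at t)"
      using heat_convolution_has_derivative_t[OF assms(3) t, of x]
      by (subst DERIV_cong_ev[OF refl _ refl]) (auto simp: vxx_def)
  qed
  have E_pos: "E t > 0" for t by (simp add: E_def)
  \<comment> \<open>The logarithm comes from the derivative of \<open>\<psi>\<close>, in which
    \<open>exp (- 2 * lam * t)\<close> cancels the growing exponential; the summand before it comes
    from differentiating that exponential.\<close>
  define E' where "E' t = E t * (2 * lam * (\<psi> t * exp (2 * lam * t) + ln (heat_bound m_inf m1 t)))" for t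
  have dE: "(E has_real_derivative E' t) (at t)" if t: "t > 0" for t
  proof -
    have "exp (- 2 * lam * t) * exp (2 * lam * t) = 1" by (simp add: exp_add[symmetric])
    then have *: "decay_rate lam m_inf \<tau> t * exp (2 * lam * t) = 2 * lam * ln (heat_bound m_inf m1 t)"
      using t by (simp add: decay_rate_def ln_heat_bound[OF m _ assms(8)] algebra_simps)
    have "((\<lambda>t. exp (2 * lam * t)) has_real_derivative exp (2 * lam * t) * (2 * lam)) (at t)"
      by (rule DERIV_fun_exp) (auto intro!: derivative_eq_intros)
    from DERIV_mult[OF decay_exponent_has_derivative[OF \<tau> t, of lam m_inf] this]
    have "((\<lambda>t. \<psi> t * exp (2 * lam * t)) has_real_derivative
        2 * lam * (\<psi> t * exp (2 * lam * t) + ln (heat_bound m_inf m1 t))) (at t)"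
      unfolding \<psi>_def * by (simp add: algebra_simps)
    then show ?thesis unfolding E_def[abs_def] E'_def by (rule DERIV_fun_exp)
  qed
  \<comment> \<open>Since \<open>v\<close> solves the heat equation, its time derivative cancels
    against the diffusion of the product, and the supersolution property reduces to this pointwise
    inequality. Where \<open>v\<close> vanishes both sides are 0; elsewhere it is
    \<open>v_le\<close> under the logarithm.\<close>
  have super: "v t x * E' t \<ge> log_nonlinearity lam (v t x * E t)" if t: "t > 0" for t x
  proof (cases "v t x = 0")
    case False
    then have vpos: "v t x > 0" using v_nonneg[of t x] by simp
    have "ln (v t x) \<le> ln (heat_bound m_inf m1 t)" using v_le[of t x] vpos t by simp
    moreover have "ln ((v t x * E t)\<^sup>2) = 2 * (ln (v t x) + \<psi> t * exp (2 * lam * t))"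
      using vpos E_pos[of t] by (simp add: ln_realpow ln_mult E_def)
    ultimately have "log_nonlinearity lam (v t x * E t)
        \<le> lam * (v t x * E t) * (2 * (ln (heat_bound m_inf m1 t) + \<psi> t * exp (2 * lam * t)))"
      using vpos E_pos[of t] lam by (auto simp: log_nonlinearity_def intro!: mult_left_mono)
    then show ?thesis by (simp add: E'_def algebra_simps)
  qed (simp add: log_nonlinearity_def)
  have main: "u t x \<le> v t x * E t" if t: "t \<ge> 0" for t x
  proof -
    define T where "T = t + 1"
    have T: "T > 0" using t by (simp add: T_def)
    obtain ut ux uxx where d: "\<forall>t\<in>{0<..T}. \<forall>x.
        ((\<lambda>s. u s x) has_real_derivative ut t x) (at t) \<and>
        ((\<lambda>y. u t y) has_real_derivative ux t x) (at x) \<and>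
        ((\<lambda>y. ux t y) has_real_derivative uxx t x) (at x)"
      and eq: "\<forall>t\<in>{0<..T}. \<forall>x. ut t x = uxx t x + log_nonlinearity lam (u t x)"
      using u T unfolding solution_from_def by blast
    have cont: "continuous_on ({0..T} \<times> UNIV) (\<lambda>(t, x). u t x)"
      and "bounded ((\<lambda>(t, x). u t x) ` ({0..T} \<times> UNIV))"
      and init: "\<And>x. u 0 x = u0 x"
      using u T unfolding solution_from_def by blast+
    then obtain M where M: "\<And>t x. t \<in> {0..T} \<Longrightarrow> \<bar>u t x\<bar> \<le> M"
      unfolding bounded_iff by fastforce
    have contE: "continuous_on {0..T} E"
      unfolding E_def \<psi>_def by (intro continuous_intros continuous_on_decay_exponent \<tau>)
    then have "bounded (E ` {0..T})"
      by (intro compact_imp_bounded compact_continuous_image) auto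
    then obtain B where "\<And>t. t \<in> {0..T} \<Longrightarrow> norm (E t) \<le> B"
      unfolding bounded_iff by blast
    then have B: "E t \<le> B" if "t \<in> {0..T}" for t
      using that abs_le_D1 by fastforce
    have w_bound: "\<bar>v t x * E t\<bar> \<le> m_inf * B" if "t \<in> {0..T}" for t x
    proof -
      have "v t x * E t \<le> m_inf * B"
        using B[OF that] E_pos[of t] m heat_flow_le_sup[OF meas nonneg le, of t x]
        by (intro mult_mono) (auto simp: v_def)
      then show ?thesis using v_nonneg[of t x] E_pos[of t] by simp
    qed
    have cont_w: "continuous_on ({0..T} \<times> UNIV) (\<lambda>(t, x). v t x * E t)"
    proof -
      have "continuous_on ({0..T} \<times> (UNIV :: real set)) (\<lambda>p. E (fst p))"
        by (rule continuous_on_compose2[OF contE]) (auto intro!: continuous_intros)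
      from continuous_on_mult[OF continuous_on_heat_flow[OF u0(1) abs] this]
      show ?thesis by (simp add: v_def case_prod_unfold)
    qed
    show ?thesis
    proof (rule log_nonlinearity_comparison[OF lam cont cont_w,
          where M = "max M (m_inf * B)" and ut = ut and ux = ux and uxx = uxx
          and wt = "\<lambda>t x. vxx t x * E t + E' t * v t x"
          and wx = "\<lambda>t x. vx t x * E t" and wxx = "\<lambda>t x. vxx t x * E t"])
      show "\<bar>u t x\<bar> \<le> max M (m_inf * B)" if "t \<in> {0..T}" for t x
        using M[OF that, of x] by simp
      show "\<bar>v t x * E t\<bar> \<le> max M (m_inf * B)" if "t \<in> {0..T}" for t x
        using w_bound[OF that, of x] by simp
      \<comment> \<open>Equality holds here: \<open>\<psi>\<close> at 0 is an integral over a single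
        point, so \<open>E 0 = 1\<close>, and the heat flow starts from \<open>u0\<close>.\<close>
      show "u 0 x \<le> v 0 x * E 0" for x
        by (simp add: init v_def E_def \<psi>_def decay_exponent_def)
      show "((\<lambda>s. v s x * E s) has_real_derivative vxx t x * E t + E' t * v t x) (at t)"
        if "t \<in> {0<..T}" for t x
        using that by (intro DERIV_mult vd(3) dE) auto
      show "((\<lambda>y. v t y * E t) has_real_derivative vx t x * E t) (at x)" if "t \<in> {0<..T}" for t x
        using that by (intro DERIV_cmult_right vd(1)) auto
      show "((\<lambda>y. vx t y * E t) has_real_derivative vxx t x * E t) (at x)" if "t \<in> {0<..T}" for t x
        using that by (intro DERIV_cmult_right vd(2)) auto
      show "vxx t x * E t + E' t * v t x \<ge> vxx t x * E t + log_nonlinearity lam (v t x * E t)"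
        if "t \<in> {0<..T}" for t x
        using super[of t x] that by (simp add: mult.commute)
    qed (use d eq t in \<open>auto simp: T_def\<close>)
  qed
  show ?thesis
  proof (intro exI[of _ \<psi>] conjI allI impI)
    show "(\<psi> \<longlongrightarrow> psi_inf lam m_inf \<tau>) at_top"
      unfolding \<psi>_def by (rule decay_exponent_tendsto[OF lam \<tau>])
  next
    fix t x :: real assume t: "t \<ge> 0"
    show "0 \<le> u t x" by (rule solution_nonneg[OF lam u nonneg t])
    have "u t x \<le> v t x * E t" by (rule main[OF t])
    also have "\<dots> \<le> heat_bound m_inf m1 t * E t"
      using v_le[OF t, of x] E_pos[of t] by (intro mult_right_mono) auto
    finally show "u t x \<le> heat_bound m_inf m1 t * exp (\<psi> t * exp (2 * lam * t))"
      by (simp add: E_def)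
  qed
qed

end
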